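(* (i) For every integer $k\geq 1$ there exists a finite simple graph with minimum degree $3k-3$ that has no $(k+1)$-connected subgraph on more than $\lceil \tfrac{4}{3}k\rceil$ vertices. (ii) There is a constant $c$ such that for every integer $k\geq 1$ there exists a finite simple graph with minimum degree at least $\big(3-\tfrac{1}{6}\big)k-c$ that has no $(k+1)$-connected subgraph.
   Context: A graph is $(k+1)$-connected if it has more than $k+1$ vertices and remains connected after deleting any set of at most $k$ vertices. *)

theory Defs
  imports Complex_Main "Graph_Theory.Digraph_Component"
begin

text \<open>
  A finite simple graph is a \<^locale>\<open>pair_graph\<close>: a finite, loop-free, symmetric digraph whose arcs
  are pairs, so that an edge \<open>uv\<close> is the pair of arcs \<open>(u, v)\<close>, \<open>(v, u)\<close> and the degree of a vertex
  is its out-degree. A subgraph in the sense of undirected graphs is a \<^const>\<open>subgraph\<close> that is itself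
  a \<^locale>\<open>pair_graph\<close>; \<^const>\<open>subgraph\<close> alone would also admit non-symmetric arc sets.
\<close>

text \<open>Unspecified for the graph without vertices, which \<^locale>\<open>pair_graph\<close> does not exclude.\<close>

definition min_degree :: "'a pair_pre_digraph \<Rightarrow> nat" where
  "min_degree G = Min (out_degree (with_proj G) ` pverts G)"

text \<open>The name \<open>connected\<close> is qualified because of topological connectedness.\<close>

definition vertex_connected :: "nat \<Rightarrow> 'a pair_pre_digraph \<Rightarrow> bool" where
  "vertex_connected m G \<longleftrightarrow>
     card (pverts G) > m \<and>
     (\<forall>S. S \<subseteq> pverts G \<and> card S < m \<longrightarrow>
        Digraph_Component.connected (with_proj G \<restriction> (pverts G - S)))"

end

theory Submission
  imports Defs
begin

text \<open>
  Start from \<open>k\<close> independent vertices and repeatedly choose a set \<open>S\<close> of \<open>k\<close> vertices, adding a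
  new gadget on \<open>k - 1\<close> vertices all of which are joined to \<open>S\<close>. Since \<open>S\<close> and the gadget are
  separators of order at most \<open>k\<close>, a \<open>(k + 1)\<close>-connected subgraph is old or consists of
  gadget vertices and vertices of one component of \<open>G[S]\<close>. The set \<open>S\<close> takes about a third of an
  earlier gadget from each of the last three gadgets, and one further vertex, so these components
  have at most \<open>k/3\<close> vertices. A complete gadget then gives (i); a complete gadget minus two
  bicliques \<open>K\<^bsub>k/6,k/6\<^esub>\<close> contains together with \<open>k/3\<close> vertices no \<open>(k + 1)\<close>-connected graph and gives (ii).

  A vertex is satisfied once it has been used in some \<open>S\<close>. As \<open>S\<close> has one vertex more than a gadget,
  the number of unsatisfied vertices drops in each step, finally below \<open>2 k\<close>. The rest is
  satisfied by repeatedly gluing two copies of the graph along \<open>k\<close> unsatisfied vertices.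
\<close>

section \<open>Vertex sets without small separations\<close>

definition ugraph :: "'a set \<Rightarrow> 'a rel \<Rightarrow> bool" where
  "ugraph V E \<longleftrightarrow> finite V \<and> E \<subseteq> V \<times> V \<and> sym E \<and> irrefl E"

text \<open>The vertex set of a \<open>(k + 1)\<close>-connected subgraph is knit. In contrast to connectivity itself,
  this only refers to the edges of the ambient graph and is monotone in them.\<close>

definition knit :: "nat \<Rightarrow> 'a rel \<Rightarrow> 'a set \<Rightarrow> bool" where
  "knit k E Z \<longleftrightarrow> finite Z \<and> card Z > k + 1 \<and>
     (\<forall>X Y. X \<union> Y = Z \<and> card (X \<inter> Y) \<le> k \<and> E \<inter> (X - Y) \<times> (Y - X) = {} \<longrightarrow> X = Z \<or> Y = Z)"

text \<open>Knit sets have more than \<open>k + 1\<close> elements, so \<open>N = 0\<close> says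
  that there are none. Thus one notion serves both (i) and (ii).\<close>

definition sparse :: "nat \<Rightarrow> nat \<Rightarrow> 'a rel \<Rightarrow> 'a set \<Rightarrow> bool" where
  "sparse k N E V \<longleftrightarrow> (\<forall>Z \<subseteq> V. knit k E Z \<longrightarrow> card Z \<le> N)"

lemma ugraphD:
  assumes "ugraph V E"
  shows "finite V" "(x, y) \<in> E \<Longrightarrow> x \<in> V" "(x, y) \<in> E \<Longrightarrow> y \<in> V"
    "(x, y) \<in> E \<Longrightarrow> (y, x) \<in> E" "(x, x) \<notin> E"
  using assms by (auto simp: ugraph_def sym_def irrefl_def)

lemma ugraph_finite_nbs: "ugraph V E \<Longrightarrow> finite (E `` A)"
  unfolding ugraph_def by (meson finite_Image finite_SigmaI finite_subset)

lemma knit_mono: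
  assumes "knit k E Z" "E \<inter> Z \<times> Z \<subseteq> E'"
  shows "knit k E' Z"
  unfolding knit_def
proof (intro conjI allI impI)
  fix X Y assume *: "X \<union> Y = Z \<and> card (X \<inter> Y) \<le> k \<and> E' \<inter> (X - Y) \<times> (Y - X) = {}"
  then have "E \<inter> (X - Y) \<times> (Y - X) = {}" using assms(2) by blast
  with * assms(1) show "X = Z \<or> Y = Z" unfolding knit_def by blast
qed (use assms in \<open>auto simp: knit_def\<close>)

text \<open>Intersecting \<open>P\<close> and \<open>Q\<close> with \<open>Z\<close> yields a
  separation of \<open>Z\<close>. In this form a separation of the ambient graph applies directly to
  every knit set in it.\<close>

lemma knit_separation:
  assumes "knit k E Z" "Z \<subseteq> P \<union> Q" "finite (P \<inter> Q)" "card (P \<inter> Q) \<le> k"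
    and "E \<inter> (P - Q) \<times> (Q - P) = {}"
  shows "Z \<subseteq> P \<or> Z \<subseteq> Q"
proof -
  have "card ((Z \<inter> P) \<inter> (Z \<inter> Q)) \<le> k"
    using card_mono[OF assms(3)] assms(4) by (meson Int_lower2 Int_mono le_trans)
  moreover have "(Z \<inter> P) \<union> (Z \<inter> Q) = Z" using assms(2) by blast
  moreover have "E \<inter> (Z \<inter> P - Z \<inter> Q) \<times> (Z \<inter> Q - Z \<inter> P) = {}" using assms(5) by blast
  ultimately have "Z \<inter> P = Z \<or> Z \<inter> Q = Z" using assms(1) unfolding knit_def by blast
  then show ?thesis by blast
qed


lemma knit_image:
  assumes h: "inj_on h V" and E: "E \<subseteq> V \<times> V" and Z: "Z \<subseteq> V"
    and kn: "knit k (map_prod h h ` E) (h ` Z)"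
  shows "knit k E Z"
  unfolding knit_def
proof (intro conjI allI impI)
  have hZ: "inj_on h Z" using h Z inj_on_subset by blast
  show "finite Z" using kn hZ finite_imageD unfolding knit_def by blast
  show "k + 1 < card Z" using kn card_image[OF hZ] unfolding knit_def by simp
  fix X Y assume *: "X \<union> Y = Z \<and> card (X \<inter> Y) \<le> k \<and> E \<inter> (X - Y) \<times> (Y - X) = {}"
  have XY: "X \<subseteq> V" "Y \<subseteq> V" using * Z by auto
  have "h ` X \<inter> h ` Y = h ` (X \<inter> Y)" using inj_on_image_Int[OF h XY] by simp
  then have "card (h ` X \<inter> h ` Y) \<le> k"
    using * card_image[of h "X \<inter> Y"] h XY by (metis inf.coboundedI1 inj_on_subset)
  moreover have "map_prod h h ` E \<inter> (h ` X - h ` Y) \<times> (h ` Y - h ` X) = {}"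
  proof -
    have no: False if e: "e \<in> map_prod h h ` E" and "fst e \<in> h ` X - h ` Y" "snd e \<in> h ` Y - h ` X" for e
    proof -
      obtain x y where xy: "(x, y) \<in> E" "e = (h x, h y)" using e by auto
      then have "x \<in> V" "y \<in> V" using E by auto
      then have "x \<in> X - Y" "y \<in> Y - X"
        using that(2,3) XY unfolding xy(2) by (simp_all add: inj_on_image_mem_iff[OF h])
      then show False using * xy(1) by blast
    qed
    show ?thesis
    proof (rule equals0I)
      fix e assume "e \<in> map_prod h h ` E \<inter> (h ` X - h ` Y) \<times> (h ` Y - h ` X)"
      then show False using no[of e] unfolding Int_iff mem_Times_iff by blast
    qed
  qed
  moreover have "h ` X \<union> h ` Y = h ` Z" using * by auto
  ultimately have "h ` X = h ` Z \<or> h ` Y = h ` Z" using kn unfolding knit_def by blast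
  then show "X = Z \<or> Y = Z" using inj_on_image_eq_iff[OF h] XY Z by blast
qed

section \<open>From connected subgraphs to knit sets, and from edge sets to graphs\<close>

lemma vertex_connected_knit:
  assumes "pair_graph H" "vertex_connected (k + 1) H" "parcs H \<subseteq> E"
  shows "knit k E (pverts H)"
  unfolding knit_def
proof (intro conjI allI impI)
  interpret pair_graph H by fact
  show "finite (pverts H)" using pair_finite_verts .
  show "k + 1 < card (pverts H)" using assms(2) unfolding vertex_connected_def by simp
  fix X Y assume *: "X \<union> Y = pverts H \<and> card (X \<inter> Y) \<le> k \<and> E \<inter> (X - Y) \<times> (Y - X) = {}"
  \<comment> \<open>Connectivity of a digraph refers to its symmetric closure, which adds nothing to
    the symmetric arcs of \<open>H\<close>.\<close>
  let ?K = "mk_symmetric (with_proj H \<restriction> (pverts H - X \<inter> Y))"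
  have "X \<inter> Y \<subseteq> pverts H" "card (X \<inter> Y) < k + 1" using * by auto
  then have conn: "Digraph_Component.connected (with_proj H \<restriction> (pverts H - X \<inter> Y))"
    using assms(2) unfolding vertex_connected_def by blast
  show "X = pverts H \<or> Y = pverts H"
  proof (rule ccontr)
    assume "\<not> ?thesis"
    then obtain x y where xy: "x \<in> X - Y" "y \<in> Y - X" using * by blast
    then have "x \<rightarrow>\<^sup>*\<^bsub>?K\<^esub> y"
      using conn * unfolding connected_def strongly_connected_def by auto
    then have "(x, y) \<in> rtrancl_on (pverts H - X \<inter> Y) (parcs ?K)"
      unfolding reachable_def by simp
    \<comment> \<open>A walk cannot leave \<open>X - Y\<close>: no arc crosses to
      \<open>Y - X\<close>, and \<open>X \<inter> Y\<close> has been deleted.\<close>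
    then have "y \<in> X - Y"
    proof (induction rule: rtrancl_on_induct)
      case base then show ?case using xy by simp
    next
      case (step y z)
      then have "(y, z) \<in> parcs H"
        using arcs_symmetric by (auto simp: parcs_mk_symmetric)
      then show ?case using step * assms(3) by blast
    qed
    then show False using xy by blast
  qed
qed

lemma sparse_no_vertex_connected:
  assumes "sparse k N E V" "pverts G = V" "parcs G \<subseteq> E"
    and "pair_graph H" "subgraph (with_proj H) (with_proj G)" "vertex_connected (k + 1) H"
  shows "card (pverts H) \<le> N"
proof -
  have "pverts H \<subseteq> V" "parcs H \<subseteq> E" using assms(2,3,5) by (auto simp: subgraph_def)
  then show ?thesis using assms(1,4,6) vertex_connected_knit unfolding sparse_def by blast
qed

text \<open>Deleting one edge lowers each degree by at most one, so edges can be removed while all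
  degrees exceed \<open>d\<close>. This produces the exact minimum degree demanded in (i).\<close>

lemma exact_min_degree:
  assumes "ugraph V E" "V \<noteq> {}" "\<forall>v \<in> V. d \<le> card (E `` {v})"
  shows "\<exists>E' \<subseteq> E. ugraph V E' \<and> (\<forall>v \<in> V. d \<le> card (E' `` {v})) \<and> (\<exists>v \<in> V. card (E' `` {v}) = d)"
  using assms
proof (induction "card E" arbitrary: E rule: less_induct)
  case less
  show ?case
  proof (cases "\<exists>v \<in> V. card (E `` {v}) = d")
    case True
    then show ?thesis using less.prems by blast
  next
    case False
    then have gt: "\<forall>v \<in> V. d < card (E `` {v})" using less.prems(3) le_neq_implies_less by metis
    obtain v where v: "v \<in> V" using less.prems(2) by blast
    then have "E `` {v} \<noteq> {}" using gt by fastforce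
    then obtain u where vu: "(v, u) \<in> E" by blast
    define E' where "E' = E - {(v, u), (u, v)}"
    have finE: "finite E"
      using less.prems(1) unfolding ugraph_def by (meson finite_SigmaI finite_subset)
    have "card E' < card E" unfolding E'_def by (rule psubset_card_mono[OF finE]) (use vu in blast)
    moreover have "ugraph V E'"
      using less.prems(1) unfolding E'_def ugraph_def sym_def irrefl_def by blast
    moreover have "d \<le> card (E' `` {w})" if "w \<in> V" for w
    proof -
      obtain z where "E `` {w} - {z} \<subseteq> E' `` {w}"
      proof (cases "w = v")
        case True
        then have "E `` {w} - {u} \<subseteq> E' `` {w}"
          using ugraphD(5)[OF less.prems(1)] vu unfolding E'_def by blast
        then show ?thesis using that by blast
      next
        case False
        then have "E `` {w} - {v} \<subseteq> E' `` {w}" unfolding E'_def by blast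
        then show ?thesis using that by blast
      qed
      then have "card (E `` {w} - {z}) \<le> card (E' `` {w})"
        using card_mono ugraph_finite_nbs[OF \<open>ugraph V E'\<close>] by blast
      moreover have "card (E `` {w}) - 1 \<le> card (E `` {w} - {z})"
        by (metis card_Diff_singleton_if diff_le_self le_refl)
      ultimately show ?thesis using gt that by fastforce
    qed
    ultimately have "\<exists>E'' \<subseteq> E'. ugraph V E'' \<and> (\<forall>v \<in> V. d \<le> card (E'' `` {v})) \<and>
        (\<exists>v \<in> V. card (E'' `` {v}) = d)"
      using less.hyps[of E'] less.prems(2) by simp
    moreover have "E' \<subseteq> E" unfolding E'_def by blast
    ultimately show ?thesis by (meson subset_trans)
  qed
qed

lemma ex_pair_graph:
  fixes V :: "'a set"
  assumes "ugraph V E" "V \<noteq> {}" "\<forall>v \<in> V. d \<le> card (E `` {v})" "sparse k N E V"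
  shows "\<exists>G :: 'a pair_pre_digraph. pair_graph G \<and> pverts G \<noteq> {} \<and> min_degree G = d \<and>
    \<not> (\<exists>H. pair_graph H \<and> subgraph (with_proj H) (with_proj G) \<and>
           vertex_connected (k + 1) H \<and> card (pverts H) > N)"
proof -
  obtain E' where E': "E' \<subseteq> E" "ugraph V E'" "\<forall>v \<in> V. d \<le> card (E' `` {v})"
      "\<exists>v \<in> V. card (E' `` {v}) = d" using exact_min_degree[OF assms(1-3)] by blast
  define G where "G = \<lparr>pverts = V, parcs = E'\<rparr>"
  have "finite E'" using E'(2) unfolding ugraph_def by (meson finite_SigmaI finite_subset)
  then have "pair_graph G"
    using E'(2) unfolding G_def
    by unfold_locales (auto simp: ugraph_def irrefl_def symmetric_def)
  moreover have "out_degree (with_proj G) v = card (E' `` {v})" for v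
  proof -
    have "out_arcs (with_proj G) v = Pair v ` (E' `` {v})" by (auto simp: out_arcs_def G_def)
    then show ?thesis by (simp add: out_degree_def card_image inj_on_def)
  qed
  then have "min_degree G = Min ((\<lambda>v. card (E' `` {v})) ` V)" by (simp add: min_degree_def G_def)
  then have "min_degree G = d"
    using E'(3,4) ugraphD(1)[OF E'(2)] by (auto intro!: Min_eqI)
  moreover have "card (pverts H) \<le> N" if "pair_graph H" "subgraph (with_proj H) (with_proj G)"
    "vertex_connected (k + 1) H" for H
    using sparse_no_vertex_connected[OF assms(4) _ _ that] E'(1) by (simp add: G_def)
  then have "\<not> (\<exists>H. pair_graph H \<and> subgraph (with_proj H) (with_proj G) \<and>
      vertex_connected (k + 1) H \<and> card (pverts H) > N)" using not_less by blast
  moreover have "pverts G \<noteq> {}" using assms(2) by (simp add: G_def)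
  ultimately show ?thesis by (intro exI[of _ G] conjI)
qed

section \<open>Doubling\<close>

text \<open>The vertices of \<open>R\<close> still lack up to \<open>k\<close> neighbours. Doubling the graph and identifying the
  copies along \<open>k\<close> vertices of \<open>R\<close> repairs these vertices, since their neighbours outside \<open>R\<close>
  are duplicated. It turns \<open>|R|\<close> into \<open>2 (|R| - k)\<close>, which is smaller as long as \<open>|R| < 2 k\<close>.\<close>

definition defective :: "nat \<Rightarrow> nat \<Rightarrow> 'a set \<Rightarrow> 'a rel \<Rightarrow> 'a set \<Rightarrow> bool" where
  "defective k d V E R \<longleftrightarrow> R \<subseteq> V \<and> (\<forall>v \<in> V - R. d \<le> card (E `` {v})) \<and>
     (\<forall>v \<in> R. d \<le> card (E `` {v}) + k \<and> k \<le> card (E `` {v} - R))"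

text \<open>The overlap is a separator of order at most \<open>k\<close>, so a knit set lies in one
  of the two graphs; by the last two hypotheses the union has no additional edges there.\<close>

lemma sparse_union:
  assumes "sparse k N E V" "sparse k N E' V'" "ugraph V E" "ugraph V' E'" "card (V \<inter> V') \<le> k"
    and "E \<inter> V' \<times> V' \<subseteq> E'" "E' \<inter> V \<times> V \<subseteq> E"
  shows "sparse k N (E \<union> E') (V \<union> V')"
  unfolding sparse_def
proof (intro allI impI)
  fix Z assume Z: "Z \<subseteq> V \<union> V'" "knit k (E \<union> E') Z"
  have E: "E \<subseteq> V \<times> V" "E' \<subseteq> V' \<times> V'" "finite (V \<inter> V')"
    using assms(3,4) unfolding ugraph_def by auto
  then have "(E \<union> E') \<inter> (V - V') \<times> (V' - V) = {}" by blast
  then have "Z \<subseteq> V \<or> Z \<subseteq> V'" using knit_separation[OF Z(2,1) E(3) assms(5)] by blast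
  then show "card Z \<le> N"
  proof
    assume "Z \<subseteq> V"
    moreover from this have "knit k E Z" using knit_mono[OF Z(2)] assms(7) by blast
    ultimately show ?thesis using assms(1) unfolding sparse_def by blast
  next
    assume "Z \<subseteq> V'"
    moreover from this have "knit k E' Z" using knit_mono[OF Z(2)] assms(6) by blast
    ultimately show ?thesis using assms(2) unfolding sparse_def by blast
  qed
qed

lemma ugraph_image:
  assumes "ugraph V E" "inj_on h V"
  shows "ugraph (h ` V) (map_prod h h ` E)"
proof -
  have E: "E \<subseteq> V \<times> V" "sym E" "irrefl E" "finite V" using assms(1) unfolding ugraph_def by auto
  have "sym (map_prod h h ` E)" using E(2) by (auto simp: sym_def)
  moreover have "irrefl (map_prod h h ` E)"
    using E(1,3) assms(2) by (fastforce simp: irrefl_def inj_on_def)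
  ultimately show ?thesis using E by (auto simp: ugraph_def)
qed

lemma sparse_image:
  assumes "sparse k N E V" "ugraph V E" "inj_on h V"
  shows "sparse k N (map_prod h h ` E) (h ` V)"
  unfolding sparse_def
proof (intro allI impI)
  fix Z assume Z: "Z \<subseteq> h ` V" "knit k (map_prod h h ` E) Z"
  obtain Y where Y: "Y \<subseteq> V" "Z = h ` Y" using Z(1) by (meson subset_imageE)
  have "E \<subseteq> V \<times> V" using assms(2) unfolding ugraph_def by auto
  then have "knit k E Y" using knit_image[OF assms(3)] Y Z(2) by blast
  then show "card Z \<le> N"
    using assms(1) Y inj_on_subset[OF assms(3)] card_image unfolding sparse_def by metis
qed

lemma doubling:
  fixes V :: "nat set"
  assumes G: "ugraph V E" "sparse k N E V" and R: "defective k d V E R"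
    and W: "W \<subseteq> R" "card W \<le> k"
  shows "\<exists>V' E' R'. ugraph V' E' \<and> sparse k N E' V' \<and> defective k d V' E' R' \<and> V \<subseteq> V' \<and>
    card R' \<le> 2 * (card R - card W)"
proof -
  have V: "finite V" "E \<subseteq> V \<times> V" "R \<subseteq> V" "W \<subseteq> V"
    using G(1) R W(1) unfolding ugraph_def defective_def by auto
  then have fin: "finite R" "finite W" using finite_subset by blast+
  obtain M where M: "\<And>v. v \<in> V \<Longrightarrow> v < M" using V(1) by (meson finite_nat_set_iff_bounded)
  \<comment> \<open>The copy fixes \<open>W\<close> and shifts all other vertices past
    \<open>V\<close>, so original and copy meet exactly in \<open>W\<close>.\<close>
  define h where "h v = (if v \<in> W then v else v + M)" for v
  have hW: "h v = v" if "v \<in> W" for v using that by (simp add: h_def)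
  have hV: "h v \<notin> V" if "v \<notin> W" for v using that M[of "v + M"] by (auto simp: h_def)
  have inj: "inj_on h V"
  proof (rule inj_onI)
    fix x y assume "x \<in> V" "y \<in> V" "h x = h y"
    then show "x = y" using M[of x] M[of y] by (auto simp: h_def split: if_splits)
  qed
  define E2 where "E2 = map_prod h h ` E"
  define R' where "R' = (R - W) \<union> h ` (R - W)"
  have G2: "ugraph (h ` V) E2" "sparse k N E2 (h ` V)"
    unfolding E2_def using ugraph_image[OF G(1) inj] sparse_image[OF G(2,1) inj] by auto
  have VV: "V \<inter> h ` V = W" using hV hW V(4) by force
  have EW: "E \<inter> h ` V \<times> h ` V \<subseteq> E2"
  proof (rule subrelI)
    fix x y assume xy: "(x, y) \<in> E \<inter> h ` V \<times> h ` V"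
    then have "x \<in> W" "y \<in> W" using VV V(2) by auto
    then have "(x, y) = map_prod h h (x, y)" using hW by simp
    then show "(x, y) \<in> E2" using xy unfolding E2_def by blast
  qed
  have EV: "E2 \<inter> V \<times> V \<subseteq> E"
  proof (rule subrelI)
    fix x y assume xy: "(x, y) \<in> E2 \<inter> V \<times> V"
    then obtain a b where ab: "(a, b) \<in> E" "x = h a" "y = h b" unfolding E2_def by auto
    then have "a \<in> W" "b \<in> W" using hV xy by blast+
    then show "(x, y) \<in> E" using ab hW by simp
  qed
  have sp: "sparse k N (E \<union> E2) (V \<union> h ` V)"
    by (rule sparse_union[OF G(2) G2(2) G(1) G2(1) _ EW EV]) (use VV W in simp)
  have ug: "ugraph (V \<union> h ` V) (E \<union> E2)"
    using G(1) G2(1) unfolding ugraph_def sym_def irrefl_def by blast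
  have nb2: "h ` (E `` {v}) \<subseteq> E2 `` {h v}" for v unfolding E2_def by auto
  have injE: "inj_on h (E `` {v})" for v using inj V(2) by (auto intro: inj_on_subset)
  have finE: "finite ((E \<union> E2) `` {v})" for v using ugraph_finite_nbs[OF ug] .
  have le1: "card (E `` {v}) \<le> card ((E \<union> E2) `` {v})" for v
    by (rule card_mono[OF finE]) blast
  have le2: "card (E `` {v}) \<le> card ((E \<union> E2) `` {h v})" for v
    using card_mono[OF finE, of "h ` (E `` {v})" "h v"] nb2[of v] card_image[OF injE[of v]] by auto
  \<comment> \<open>Neighbours outside \<open>R\<close> stay outside \<open>R'\<close>, for
    originals and copies alike, so the remaining deficient vertices can be repaired by later
    doublings.\<close>
  have outer: "E `` {v} - R \<subseteq> - R'" for v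
    using V(2,3) hV unfolding R'_def by (auto simp: inj_on_eq_iff)
  have inner: "h x \<notin> R'" if "x \<in> V" "x \<notin> R" for x
  proof -
    have "h x \<notin> V" using hV that W by blast
    moreover have "h x \<noteq> h y" if "y \<in> R" for y
      using that \<open>x \<in> V\<close> \<open>x \<notin> R\<close> V(3) inj by (metis inj_on_eq_iff subsetD)
    ultimately show ?thesis using V(3) unfolding R'_def by blast
  qed
  have deg: "d \<le> card (E `` {v})" if "v \<in> V - R" for v
    using R that unfolding defective_def by blast
  have degR: "d \<le> card (E `` {v}) + k" "k \<le> card (E `` {v} - R)" if "v \<in> R" for v
    using R that unfolding defective_def by blast+
  have "d \<le> card ((E \<union> E2) `` {v})" if v: "v \<in> (V \<union> h ` V) - R'" for v
  proof -
    consider "v \<in> V - R" | "v \<in> W" | u where "u \<in> V - R" "v = h u"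
    proof (cases "v \<in> V")
      case True
      then show ?thesis using v that(1,2) unfolding R'_def by blast
    next
      case False
      then obtain u where u: "u \<in> V" "v = h u" using v by blast
      then have "u \<notin> W" using False hW V(4) by auto
      then have "u \<notin> R" using u(2) v unfolding R'_def by blast
      then show ?thesis using u that(3) by blast
    qed
    then show ?thesis
    proof cases
      case 1
      then show ?thesis using deg le1 order_trans by blast
    next
      case 2
      \<comment> \<open>The neighbours of \<open>v\<close> outside \<open>R\<close> are not in
        \<open>W\<close>, so their copies are new neighbours of \<open>v\<close>. There are at least
        \<open>k\<close> of them, which makes up the deficit.\<close>
      let ?O = "E `` {v} - R"
      have "E `` {v} \<union> h ` ?O \<subseteq> (E \<union> E2) `` {v}" using nb2[of v] hW[OF 2] by auto
      then have "card (E `` {v} \<union> h ` ?O) \<le> card ((E \<union> E2) `` {v})" using card_mono[OF finE] by blast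
      moreover have "card (E `` {v} \<union> h ` ?O) = card (E `` {v}) + card (h ` ?O)"
      proof (rule card_Un_disjoint)
        show "finite (E `` {v})" using ugraph_finite_nbs[OF G(1)] .
        then show "finite (h ` ?O)" by blast
        show "E `` {v} \<inter> h ` ?O = {}" using hV W(1) V(2) by blast
      qed
      moreover have "card (h ` ?O) = card ?O" using injE by (meson Diff_subset card_image inj_on_subset)
      ultimately show ?thesis using degR[of v] 2 W(1) by fastforce
    next
      case 3
      then show ?thesis using deg le2 order_trans by blast
    qed
  qed
  moreover have "d \<le> card ((E \<union> E2) `` {v}) + k \<and> k \<le> card ((E \<union> E2) `` {v} - R')" if v: "v \<in> R'" for v
  proof -
    have fin': "finite ((E \<union> E2) `` {v} - R')" using finE by blast
    consider "v \<in> R - W" | u where "u \<in> R - W" "v = h u" using v unfolding R'_def by blast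
    then show ?thesis
    proof cases
      case 1
      have "E `` {v} - R \<subseteq> (E \<union> E2) `` {v} - R'" using outer[of v] by blast
      then have "card (E `` {v} - R) \<le> card ((E \<union> E2) `` {v} - R')" using card_mono[OF fin'] by blast
      then show ?thesis using degR[of v] le1[of v] 1 by auto
    next
      case 2
      have "h ` (E `` {u} - R) \<subseteq> (E \<union> E2) `` {v} - R'"
        using inner V(2) nb2[of u] 2(2) by blast
      then have "card (h ` (E `` {u} - R)) \<le> card ((E \<union> E2) `` {v} - R')"
        using card_mono[OF fin'] by blast
      moreover have "card (h ` (E `` {u} - R)) = card (E `` {u} - R)"
        using injE by (meson Diff_subset card_image inj_on_subset)
      ultimately show ?thesis using degR[of u] le2[of u] 2 by auto
    qed
  qed
  ultimately have "defective k d (V \<union> h ` V) (E \<union> E2) R'"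
    using V(3) unfolding defective_def R'_def by blast
  moreover have "card R' \<le> 2 * (card R - card W)"
  proof -
    have "card R' \<le> card (R - W) + card (h ` (R - W))" unfolding R'_def by (rule card_Un_le)
    also have "\<dots> \<le> card (R - W) + card (R - W)" using card_image_le[of "R - W" h] fin by simp
    also have "card (R - W) = card R - card W" using card_Diff_subset[OF fin(2) W(1)] .
    finally show ?thesis by simp
  qed
  ultimately show ?thesis using ug sp by blast
qed

lemma complete_defective:
  fixes V :: "nat set"
  assumes "ugraph V E" "sparse k N E V" "V \<noteq> {}" "defective k d V E R" "card R < 2 * k"
  shows "\<exists>V' E'. ugraph V' E' \<and> sparse k N E' V' \<and> V' \<noteq> ({} :: nat set) \<and> (\<forall>v \<in> V'. d \<le> card (E' `` {v}))"
  using assms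
proof (induction "card R" arbitrary: V E R rule: less_induct)
  case less
  show ?case
  proof (cases "R = {}")
    case True
    then show ?thesis using less.prems unfolding defective_def by (intro exI[of _ V] exI[of _ E]) auto
  next
    case False
    have "finite R"
      using less.prems(1,4) finite_subset unfolding ugraph_def defective_def by blast
    then have "0 < card R" using False by (simp add: card_gt_0_iff)
    obtain W where W: "W \<subseteq> R" "card W = min k (card R)"
      using obtain_subset_with_card_n[of "min k (card R)" R] by auto
    then obtain V' E' R' where *: "ugraph V' E'" "sparse k N E' V'" "defective k d V' E' R'" "V \<subseteq> V'"
        "card R' \<le> 2 * (card R - card W)"
      using doubling[OF less.prems(1,2,4)] by (metis min.cobounded1)
    then have "card R' < card R" using W(2) \<open>0 < card R\<close> less.prems(5) by linarith
    then show ?thesis using less.hyps[of R' V' E'] * less.prems(3,5) by auto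
  qed
qed

section \<open>Gadgets\<close>

text \<open>\<open>A\<close> stands for the vertices of \<open>S\<close> that one knit set can use.
  \<open>E\<close> is unrestricted inside and towards \<open>A\<close>, so the property does not
  depend on where the gadget is attached.\<close>

definition gadget :: "nat \<Rightarrow> nat \<Rightarrow> nat \<Rightarrow> 'a set \<Rightarrow> 'a rel \<Rightarrow> bool" where
  "gadget k N p C F \<longleftrightarrow> (\<forall>A E Z. finite A \<and> card A \<le> p \<and> E \<inter> C \<times> C \<subseteq> F \<and> Z \<subseteq> C \<union> A \<and> knit k E Z
     \<longrightarrow> card Z \<le> N)"

lemma complete_gadget:
  assumes "finite C" "card C + p \<le> N"
  shows "gadget k N p C F"
  unfolding gadget_def
proof (intro allI impI)
  fix A E Z assume *: "finite A \<and> card A \<le> p \<and> E \<inter> C \<times> C \<subseteq> F \<and> Z \<subseteq> C \<union> A \<and> knit k E Z"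
  then have "card Z \<le> card (C \<union> A)" using assms(1) card_mono by (metis finite_UnI)
  also have "\<dots> \<le> card C + card A" by (rule card_Un_le)
  finally show "card Z \<le> N" using * assms(2) by linarith
qed

lemma disjoint_quadruple:
  assumes "4 * b \<le> card C"
  shows "\<exists>B1 B2 B3 B4. B1 \<union> B2 \<union> B3 \<union> B4 \<subseteq> C \<and> card B1 = b \<and> card B2 = b \<and> card B3 = b \<and> card B4 = b \<and>
    B1 \<inter> B2 = {} \<and> B3 \<inter> B4 = {} \<and> (B1 \<union> B2) \<inter> (B3 \<union> B4) = {} \<and> finite (B1 \<union> B2 \<union> B3 \<union> B4)"
proof -
  obtain D where D: "D \<subseteq> C" "card D = 4 * b" "finite D" using assms by (rule obtain_subset_with_card_n)
  obtain B1 where B1: "B1 \<subseteq> D" "card B1 = b" using D(2) obtain_subset_with_card_n[of b D] by auto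
  then have "card (D - B1) = 3 * b" using D by (simp add: card_Diff_subset finite_subset)
  then obtain B2 where B2: "B2 \<subseteq> D - B1" "card B2 = b" using obtain_subset_with_card_n[of b "D - B1"] by auto
  then have "card (D - B1 - B2) = 2 * b"
    using D(3) \<open>card (D - B1) = 3 * b\<close> by (simp add: card_Diff_subset finite_subset)
  then obtain B3 where B3: "B3 \<subseteq> D - B1 - B2" "card B3 = b"
    using obtain_subset_with_card_n[of b "D - B1 - B2"] by auto
  then have "card (D - B1 - B2 - B3) = b"
    using D(3) \<open>card (D - B1 - B2) = 2 * b\<close> by (simp add: card_Diff_subset finite_subset)
  then have "B1 \<union> B2 \<union> B3 \<union> (D - B1 - B2 - B3) \<subseteq> C \<and> card B1 = b \<and> card B2 = b \<and> card B3 = b \<and>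
      card (D - B1 - B2 - B3) = b \<and> B1 \<inter> B2 = {} \<and> B3 \<inter> (D - B1 - B2 - B3) = {} \<and>
      (B1 \<union> B2) \<inter> (B3 \<union> (D - B1 - B2 - B3)) = {} \<and>
      finite (B1 \<union> B2 \<union> B3 \<union> (D - B1 - B2 - B3))"
    using B1 B2 B3 D(1,3) by (auto dest: finite_subset)
  then show ?thesis by blast
qed

text \<open>Removing the biclique between \<open>B1\<close> and \<open>B2\<close> makes the rest of \<open>Z\<close> a separator, which has at
  most \<open>k\<close> vertices. Hence \<open>Z\<close> misses one side of each biclique, and then it is too small.\<close>

lemma biclique_gadget:
  fixes C :: "'a set"
  assumes C: "finite C" "card C = k - 1" and b: "4 * b \<le> k - 1" "p \<le> 2 * b + 1" and "k \<ge> 1"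
  shows "\<exists>F. ugraph C F \<and> (\<forall>v \<in> C. k - 2 \<le> card (F `` {v}) + b) \<and> gadget k N p C F"
proof -
  obtain B1 B2 B3 B4 where B: "B1 \<union> B2 \<union> B3 \<union> B4 \<subseteq> C" "card B1 = b" "card B2 = b" "card B3 = b"
      "card B4 = b" "B1 \<inter> B2 = {}" "B3 \<inter> B4 = {}" "(B1 \<union> B2) \<inter> (B3 \<union> B4) = {}"
      "finite (B1 \<union> B2 \<union> B3 \<union> B4)"
    using disjoint_quadruple[of b C] b(1) C(2) by auto
  define F where "F = {(x, y) \<in> C \<times> C. x \<noteq> y} - (B1 \<times> B2 \<union> B2 \<times> B1 \<union> B3 \<times> B4 \<union> B4 \<times> B3)"
  have "ugraph C F" using C(1) unfolding ugraph_def F_def sym_def irrefl_def by auto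
  moreover have "k - 2 \<le> card (F `` {v}) + b" if v: "v \<in> C" for v
  proof -
    \<comment> \<open>Besides \<open>v\<close> itself, the only non-neighbours of \<open>v\<close>
      in \<open>C\<close> form the opposite side of its biclique.\<close>
    define D where
      "D = (if v \<in> B1 then B2 else if v \<in> B2 then B1 else if v \<in> B3 then B4 else if v \<in> B4 then B3 else {})"
    have D: "card D \<le> b" "finite D" using B(2-5,9) unfolding D_def by auto
    have "C - insert v D \<subseteq> F `` {v}" using v B(6-8) unfolding F_def D_def by auto
    then have "card (C - insert v D) \<le> card (F `` {v})"
      using card_mono ugraph_finite_nbs[OF \<open>ugraph C F\<close>] by blast
    moreover have "card C - card (insert v D) \<le> card (C - insert v D)"
      using diff_card_le_card_Diff D(2) by blast
    moreover have "card (insert v D) \<le> b + 1" using D card_insert_le_m1[of "b + 1" D v] by simp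
    ultimately show ?thesis using C(2) by linarith
  qed
  moreover have "gadget k N p C F"
    unfolding gadget_def
  proof (intro allI impI)
    fix A E Z assume *: "finite A \<and> card A \<le> p \<and> E \<inter> C \<times> C \<subseteq> F \<and> Z \<subseteq> C \<union> A \<and> knit k E Z"
    \<comment> \<open>Here \<open>p \<le> 2 * b + 1\<close> enters: at most
      \<open>(k - 1) - 2 * b + p \<le> k\<close> vertices remain.\<close>
    have small: "card (Z - D) \<le> k" if D: "D \<subseteq> C" "card D = 2 * b" for D
    proof -
      have "Z - D \<subseteq> (C - D) \<union> A" using * by blast
      then have "card (Z - D) \<le> card ((C - D) \<union> A)" using * C(1) card_mono by (metis finite_Diff finite_UnI)
      also have "\<dots> \<le> card (C - D) + card A" by (rule card_Un_le)
      also have "card (C - D) = card C - card D" using D C(1) by (meson card_Diff_subset finite_subset)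
      finally show ?thesis using * D C(2) b \<open>k \<ge> 1\<close> by linarith
    qed
    have miss: "Z \<inter> D = {} \<or> Z \<inter> D' = {}"
      if D: "D \<union> D' \<subseteq> C" "D \<inter> D' = {}" "card D = b" "card D' = b" "D \<times> D' \<inter> F = {}" for D D'
    proof -
      have fin: "finite Z" "finite D" "finite D'"
        using * D(1) finite_subset[OF _ C(1)] by (auto simp: knit_def)
      then have "card (D \<union> D') = 2 * b" using D(2-4) by (simp add: card_Un_disjoint)
      then have "card (Z - (D \<union> D')) \<le> k" using small D(1) by blast
      moreover have "(Z - D') \<inter> (Z - D) = Z - (D \<union> D')" by blast
      moreover have "E \<inter> ((Z - D') - (Z - D)) \<times> ((Z - D) - (Z - D')) = {}" using * D(1,5) by blast
      ultimately have "Z \<subseteq> Z - D' \<or> Z \<subseteq> Z - D"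
        using knit_separation[of k E Z "Z - D'" "Z - D"] * D(2) fin(1) by auto
      then show ?thesis by blast
    qed
    have "Z \<inter> B1 = {} \<or> Z \<inter> B2 = {}" by (rule miss) (use B in \<open>auto simp: F_def\<close>)
    moreover have "Z \<inter> B3 = {} \<or> Z \<inter> B4 = {}" by (rule miss) (use B in \<open>auto simp: F_def\<close>)
    ultimately obtain D D' where D: "D \<in> {B1, B2}" "D' \<in> {B3, B4}" "Z \<inter> (D \<union> D') = {}" by blast
    have "D \<inter> D' = {}" "card D = b" "card D' = b" "finite D" "finite D'" using D(1,2) B by auto
    then have "card (D \<union> D') = 2 * b" by (simp add: card_Un_disjoint)
    moreover have "D \<union> D' \<subseteq> C" using D B(1) by blast
    ultimately have "card (Z - (D \<union> D')) \<le> k" using small by blast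
    moreover have "Z - (D \<union> D') = Z" using D(3) by blast
    ultimately show "card Z \<le> N" using * unfolding knit_def by simp
  qed
  ultimately show ?thesis by blast
qed

lemma sum_thirds: "(k + 1) div 3 + k div 3 + (k - 1) div 3 = k - (1 :: nat)"
proof -
  obtain j r where k: "k = 3 * j + r" "r < 3" by (metis mod_less_divisor mult_div_mod_eq zero_less_numeral)
  then consider "r = 0" "j = 0" | i where "r = 0" "j = i + 1" | "r = 1" | "r = 2"
    by (metis One_nat_def Suc_1 Suc_eq_plus1 less_Suc_eq not0_implies_Suc numeral_3_eq_3 not_less_zero)
  then show ?thesis
  proof cases
    case 2
    have "(k + 1) div 3 = j" "k div 3 = j" "(k - 1) div 3 = i"
      by (rule div_nat_eqI; use k(1) 2 in simp)+
    then show ?thesis using k(1) 2 by simp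
  next
    case 3
    have "(k + 1) div 3 = j" "k div 3 = j" "(k - 1) div 3 = j"
      by (rule div_nat_eqI; use k(1) 3 in simp)+
    then show ?thesis using k(1) 3 by simp
  next
    case 4
    have "(k + 1) div 3 = j + 1" "k div 3 = j" "(k - 1) div 3 = j"
      by (rule div_nat_eqI; use k(1) 4 in simp)+
    then show ?thesis using k(1) 4 by simp
  qed (use k in simp)
qed

section \<open>Attaching gadgets\<close>

locale gadgets =
  fixes k N p b :: nat
  assumes k: "k \<ge> 2" and p: "(k + 1) div 3 \<le> p" 
    and gadget: "\<And>C :: nat set. finite C \<Longrightarrow> card C = k - 1 \<Longrightarrow>
      \<exists>F. ugraph C F \<and> (\<forall>v \<in> C. k - 2 \<le> card (F `` {v}) + b) \<and> gadget k N p C F"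
begin

lemma attach:
  fixes V :: "nat set"
  assumes G: "ugraph V E" "sparse k N E V"
    and S: "S \<subseteq> V" "card S = k"
    and f: "\<And>x y. (x, y) \<in> E \<Longrightarrow> x \<in> S \<Longrightarrow> y \<in> S \<Longrightarrow> f x = f y"
      "\<And>c. card {x \<in> S. f x = c} \<le> p"
  obtains C F E' where "finite C" "card C = k - 1" "C \<inter> V = {}" "ugraph C F"
    "\<forall>v \<in> C. k - 2 \<le> card (F `` {v}) + b" "E' = E \<union> F \<union> S \<times> C \<union> C \<times> S"
    "ugraph (V \<union> C) E'" "sparse k N E' (V \<union> C)"
proof -
  have V: "finite V" "E \<subseteq> V \<times> V" using G(1) unfolding ugraph_def by auto
  obtain M where M: "\<And>v. v \<in> V \<Longrightarrow> v < M" using V(1) by (meson finite_nat_set_iff_bounded)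
  define C where "C = {M..<M + (k - 1)}"
  have C: "finite C" "card C = k - 1" "C \<inter> V = {}" unfolding C_def using M by force+
  obtain F where F: "ugraph C F" "\<forall>v \<in> C. k - 2 \<le> card (F `` {v}) + b" "gadget k N p C F"
    using gadget C by blast
  have FC: "F \<subseteq> C \<times> C" using F(1) unfolding ugraph_def by blast
  have finS: "finite S" using S(1) V(1) finite_subset by blast
  define E' where "E' = E \<union> F \<union> S \<times> C \<union> C \<times> S"
  have "ugraph (V \<union> C) E'"
    using G(1) F(1) C(1,3) S(1) unfolding E'_def ugraph_def sym_def irrefl_def by auto
  moreover have "sparse k N E' (V \<union> C)"
    unfolding sparse_def
  proof (intro allI impI)
    fix Z assume Z: "Z \<subseteq> V \<union> C" "knit k E' Z"
    have "V \<inter> (S \<union> C) = S" using C(3) S(1) by blast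
    moreover have "E' \<inter> (V - (S \<union> C)) \<times> (S \<union> C - V) = {}"
      using V(2) FC C(3) unfolding E'_def by blast
    ultimately have "Z \<subseteq> V \<or> Z \<subseteq> S \<union> C"
      using knit_separation[OF Z(2), of V "S \<union> C"] Z(1) S finS by auto
    then show "card Z \<le> N"
    proof
      assume ZV: "Z \<subseteq> V"
      have "E' \<inter> Z \<times> Z \<subseteq> E" using ZV FC C(3) unfolding E'_def by blast
      then show ?thesis using knit_mono[OF Z(2)] G(2) ZV unfolding sparse_def by blast
    next
      assume ZS: "Z \<subseteq> S \<union> C"
      have "\<exists>A. finite A \<and> card A \<le> p \<and> Z \<subseteq> C \<union> A"
      proof (cases "Z \<subseteq> C")
        case True
        then show ?thesis by (intro exI[of _ "{}"]) auto
      next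
        case False
        then obtain x where x: "x \<in> Z" "x \<in> S" using ZS by blast
        let ?A = "{y \<in> S. f y = f x}" and ?B = "{y \<in> S. f y \<noteq> f x}"
        have "(C \<union> ?A) \<inter> (C \<union> ?B) = C" by blast
        moreover have "E' \<inter> (C \<union> ?A - (C \<union> ?B)) \<times> (C \<union> ?B - (C \<union> ?A)) = {}"
          using f(1) FC S(1) C(3) unfolding E'_def by fastforce
        moreover have "Z \<subseteq> (C \<union> ?A) \<union> (C \<union> ?B)" using ZS by blast
        ultimately have "Z \<subseteq> C \<union> ?A \<or> Z \<subseteq> C \<union> ?B"
          using knit_separation[OF Z(2), of "C \<union> ?A" "C \<union> ?B"] C(1,2) by simp
        moreover have "x \<notin> C \<union> ?B" using x S(1) C(3) by blast
        ultimately have "Z \<subseteq> C \<union> ?A" using x(1) by blast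
        moreover have "finite ?A" using finS by simp
        ultimately show ?thesis using f(2) by blast
      qed
      moreover have "E' \<inter> C \<times> C \<subseteq> F" using V(2) S(1) C(3) unfolding E'_def by blast
      ultimately show ?thesis using F(3) Z(2) unfolding gadget_def by blast
    qed
  qed
  ultimately show ?thesis using that C F E'_def by blast
qed

text \<open>Colour \<open>0\<close> marks satisfied vertices; colours \<open>1\<close>, \<open>2\<close>, \<open>3\<close> mark the unsatisfied vertices of
  the last three gadgets, newest first, and colour \<open>4\<close> a reserve of other unsatisfied vertices.\<close>

definition staged :: "nat set \<Rightarrow> nat rel \<Rightarrow> (nat \<Rightarrow> nat) \<Rightarrow> bool" where
  "staged V E g \<longleftrightarrow> ugraph V E \<and> sparse k N E V \<and>
     (\<forall>x y. (x, y) \<in> E \<longrightarrow> g x \<noteq> 0 \<longrightarrow> g y \<noteq> 0 \<longrightarrow> g x = g y) \<and>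
     (\<forall>v \<in> V. g v = 0 \<longrightarrow> 3 * k - 3 \<le> card (E `` {v}) + b) \<and>
     (\<forall>v \<in> V. g v \<noteq> 0 \<longrightarrow> 2 * k - 2 \<le> card (E `` {v}) + b \<and> k \<le> card {u \<in> E `` {v}. g u = 0})"

definition stage :: "nat set \<Rightarrow> nat rel \<Rightarrow> (nat \<Rightarrow> nat) \<Rightarrow> nat \<Rightarrow> nat \<Rightarrow> nat \<Rightarrow> bool" where
  "stage V E g m2 m3 m4 \<longleftrightarrow> staged V E g \<and> (\<forall>v \<in> V. g v \<le> 4) \<and> card {v \<in> V. g v = 1} = k - 1 \<and>
     card {v \<in> V. g v = 2} = m2 \<and> card {v \<in> V. g v = 3} = m3 \<and> card {v \<in> V. g v = 4} = m4"

lemma advance: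
  assumes st: "stage V E g m2 m3 m4" and s: "s1 + s2 + s3 = k - 1" "s1 \<le> p" "s2 \<le> p" "s3 \<le> p"
    and m: "s2 \<le> m2" "s3 \<le> m3" "1 \<le> m4"
  shows "\<exists>V' E' g'. stage V' E' g' (k - 1 - s1) (m2 - s2) (m4 - 1 + (m3 - s3))"
proof -
  have "ugraph V E" and sp: "sparse k N E V"
    and mono: "\<And>x y. (x, y) \<in> E \<Longrightarrow> g x \<noteq> 0 \<Longrightarrow> g y \<noteq> 0 \<Longrightarrow> g x = g y"
    and sat: "\<And>v. v \<in> V \<Longrightarrow> g v = 0 \<Longrightarrow> 3 * k - 3 \<le> card (E `` {v}) + b"
    and uns: "\<And>v. v \<in> V \<Longrightarrow> g v \<noteq> 0 \<Longrightarrow> 2 * k - 2 \<le> card (E `` {v}) + b"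
      "\<And>v. v \<in> V \<Longrightarrow> g v \<noteq> 0 \<Longrightarrow> k \<le> card {u \<in> E `` {v}. g u = 0}"
    and g4: "\<And>v. v \<in> V \<Longrightarrow> g v \<le> 4"
    and c: "card {v \<in> V. g v = 1} = k - 1" "card {v \<in> V. g v = 2} = m2"
      "card {v \<in> V. g v = 3} = m3" "card {v \<in> V. g v = 4} = m4"
    using st unfolding stage_def staged_def by auto
  note ug = \<open>ugraph V E\<close>
  have V: "finite V" "E \<subseteq> V \<times> V" using ug unfolding ugraph_def by auto
  obtain S1 where S1: "S1 \<subseteq> {v \<in> V. g v = 1}" "card S1 = s1" "finite S1"
    using obtain_subset_with_card_n[of s1] c(1) s(1) by (metis le_add1 add.assoc)
  obtain S2 where S2: "S2 \<subseteq> {v \<in> V. g v = 2}" "card S2 = s2" "finite S2"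
    using obtain_subset_with_card_n[of s2] c(2) m(1) by metis
  obtain S3 where S3: "S3 \<subseteq> {v \<in> V. g v = 3}" "card S3 = s3" "finite S3"
    using obtain_subset_with_card_n[of s3] c(3) m(2) by metis
  obtain S4 where S4: "S4 \<subseteq> {v \<in> V. g v = 4}" "card S4 = 1" "finite S4"
    using obtain_subset_with_card_n[of 1] c(4) m(3) by metis
  define S where "S = S1 \<union> S2 \<union> S3 \<union> S4"
  have cls: "{v \<in> S. g v = 1} = S1" "{v \<in> S. g v = 2} = S2" "{v \<in> S. g v = 3} = S3"
      "{v \<in> S. g v = 4} = S4"
    using S1(1) S2(1) S3(1) S4(1) unfolding S_def by auto
  have SV: "S \<subseteq> V" and gS: "\<And>v. v \<in> S \<Longrightarrow> g v \<in> {1, 2, 3, 4}"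
    using S1(1) S2(1) S3(1) S4(1) unfolding S_def by auto
  have "S1 \<inter> S2 = {}" "(S1 \<union> S2) \<inter> S3 = {}" "(S1 \<union> S2 \<union> S3) \<inter> S4 = {}"
    using S1(1) S2(1) S3(1) S4(1) by force+
  then have "card S = card S1 + card S2 + card S3 + card S4"
    using S1(3) S2(3) S3(3) S4(3) by (simp add: S_def card_Un_disjoint)
  then have cS: "card S = k" using S1(2) S2(2) S3(2) S4(2) s(1) k by linarith
  have p1: "1 \<le> p" using p k by linarith
  have cp: "card {v \<in> S. g v = i} \<le> p" for i
  proof (cases "i \<in> {1, 2, 3, 4}")
    case True
    then show ?thesis using cls S1(2) S2(2) S3(2) S4(2) s p1 by auto
  next
    case False
    then have "{v \<in> S. g v = i} = {}" using gS by blast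
    then show ?thesis by (metis card.empty le0)
  qed
  have mS: "g x = g y" if "(x, y) \<in> E" "x \<in> S" "y \<in> S" for x y
    using mono[OF that(1)] gS[OF that(2)] gS[OF that(3)] by auto
  obtain C F E' where C: "finite C" "card C = k - 1" "C \<inter> V = {}" and F: "ugraph C F"
      "\<forall>v \<in> C. k - 2 \<le> card (F `` {v}) + b" and E': "E' = E \<union> F \<union> S \<times> C \<union> C \<times> S"
      and G': "ugraph (V \<union> C) E'" "sparse k N E' (V \<union> C)"
    using attach[OF ug sp SV cS mS cp] by blast
  have FC: "F \<subseteq> C \<times> C" using F(1) unfolding ugraph_def by blast
  have finS: "finite S" using SV V(1) finite_subset by blast
  define g' where "g' v = (if v \<in> C then 1 else if v \<in> S then 0 else
    if g v = 0 \<or> g v = 4 then g v else g v + 1)" for v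
  have nbV: "E' `` {v} = E `` {v}" if "v \<in> V - S" for v
    using that C(3) FC E' by blast
  have nbS: "E' `` {v} = E `` {v} \<union> C" if "v \<in> S" for v
    using that C(3) FC E' SV by blast
  have nbC: "E' `` {v} = F `` {v} \<union> S" if "v \<in> C" for v
    using that C(3) V(2) E' SV by blast
  have finsat: "finite {u \<in> E' `` {v}. P u}" for v P
    by (rule finite_subset[OF _ ugraph_finite_nbs[OF G'(1), of "{v}"]]) blast
  have dS: "card (E' `` {v}) = card (E `` {v}) + (k - 1)" if "v \<in> S" for v
    unfolding nbS[OF that] using card_Un_disjoint[of "E `` {v}" C] ugraph_finite_nbs[OF ug] C V(2)
    by auto
  have dC: "card (E' `` {v}) = card (F `` {v}) + k" if "v \<in> C" for v
    unfolding nbC[OF that] using card_Un_disjoint[of "F `` {v}" S] ugraph_finite_nbs[OF F(1)] finS cS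
      C(3) FC SV by auto
  have "g' x = g' y" if xy: "(x, y) \<in> E'" "g' x \<noteq> 0" "g' y \<noteq> 0" for x y
  proof -
    have "x \<in> C \<or> x \<notin> S" "y \<in> C \<or> y \<notin> S" using xy(2,3) unfolding g'_def by auto
    then have "x \<notin> S" "y \<notin> S" using SV C(3) by auto
    then consider "(x, y) \<in> E" | "(x, y) \<in> F" using xy(1) E' by blast
    then show ?thesis
    proof cases
      case 1
      then have "x \<notin> C" "y \<notin> C" using V(2) C(3) by auto
      then have "g x \<noteq> 0" "g y \<noteq> 0" using xy(2,3) \<open>x \<notin> S\<close> \<open>y \<notin> S\<close> unfolding g'_def
        by (auto split: if_splits)
      then show ?thesis using mono[OF 1] \<open>x \<notin> C\<close> \<open>y \<notin> C\<close> \<open>x \<notin> S\<close> \<open>y \<notin> S\<close> unfolding g'_def by auto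
    next
      case 2
      then have "x \<in> C" "y \<in> C" using FC by auto
      then show ?thesis unfolding g'_def by simp
    qed
  qed
  moreover have "3 * k - 3 \<le> card (E' `` {v}) + b" if v: "v \<in> V \<union> C" "g' v = 0" for v
  proof (cases "v \<in> S")
    case True
    then have "2 * k - 2 \<le> card (E `` {v}) + b" using uns(1) SV gS by fastforce
    then show ?thesis using dS[OF True] by linarith
  next
    case False
    then have "v \<in> V - S" "g v = 0" using v unfolding g'_def by (auto split: if_splits)
    then show ?thesis using sat nbV by auto
  qed
  moreover have "2 * k - 2 \<le> card (E' `` {v}) + b \<and> k \<le> card {u \<in> E' `` {v}. g' u = 0}"
    if v: "v \<in> V \<union> C" "g' v \<noteq> 0" for v
  proof (cases "v \<in> C")
    case True
    have "S \<subseteq> {u \<in> E' `` {v}. g' u = 0}"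
      using nbC[OF True] SV C(3) unfolding g'_def by auto
    then have "card S \<le> card {u \<in> E' `` {v}. g' u = 0}" by (intro card_mono finsat)
    moreover have "k - 2 \<le> card (F `` {v}) + b" using F(2) True by blast
    ultimately show ?thesis using dC[OF True] cS by linarith
  next
    case False
    then have vS: "v \<in> V - S" and "g v \<noteq> 0" using v unfolding g'_def by (auto split: if_splits)
    have "{u \<in> E `` {v}. g u = 0} \<subseteq> {u \<in> E' `` {v}. g' u = 0}"
      unfolding nbV[OF vS] using V(2) C(3) unfolding g'_def by auto
    then have "card {u \<in> E `` {v}. g u = 0} \<le> card {u \<in> E' `` {v}. g' u = 0}"
      by (intro card_mono finsat)
    then show ?thesis using uns[of v] vS \<open>g v \<noteq> 0\<close> nbV[OF vS] by auto
  qed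
  ultimately have "staged (V \<union> C) E' g'" using G' unfolding staged_def by blast
  moreover have "g' v \<le> 4" if "v \<in> V \<union> C" for v
    using g4[of v] that unfolding g'_def by auto
  moreover have "{v \<in> V \<union> C. g' v = 1} = C" unfolding g'_def by auto
  moreover have "{v \<in> V \<union> C. g' v = 2} = {v \<in> V. g v = 1} - S1"
    using C(3) cls(1) S1(1) unfolding g'_def by (auto split: if_splits)
  moreover have "card ({v \<in> V. g v = 1} - S1) = k - 1 - s1"
    using card_Diff_subset[OF S1(3,1)] c(1) S1(2) by simp
  moreover have "{v \<in> V \<union> C. g' v = 3} = {v \<in> V. g v = 2} - S2"
    using C(3) cls(2) S2(1) unfolding g'_def by (auto split: if_splits)
  moreover have "card ({v \<in> V. g v = 2} - S2) = m2 - s2"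
    using card_Diff_subset[OF S2(3,1)] c(2) S2(2) by simp
  moreover have "{v \<in> V \<union> C. g' v = 4} = ({v \<in> V. g v = 4} - S4) \<union> ({v \<in> V. g v = 3} - S3)"
    using C(3) cls(3,4) S3(1) S4(1) unfolding g'_def by (auto split: if_splits)
  moreover have "card (({v \<in> V. g v = 4} - S4) \<union> ({v \<in> V. g v = 3} - S3)) = m4 - 1 + (m3 - s3)"
  proof -
    have "card (({v \<in> V. g v = 4} - S4) \<union> ({v \<in> V. g v = 3} - S3))
        = card ({v \<in> V. g v = 4} - S4) + card ({v \<in> V. g v = 3} - S3)"
      by (rule card_Un_disjoint) (use V(1) in auto)
    then show ?thesis
      using card_Diff_subset[OF S3(3,1)] card_Diff_subset[OF S4(3,1)] c(3,4) S3(2) S4(2) by simp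
  qed
  ultimately have "stage (V \<union> C) E' g' (k - 1 - s1) (m2 - s2) (m4 - 1 + (m3 - s3))"
    using C(2) unfolding stage_def by simp
  then show ?thesis by blast
qed

definition hub :: "nat \<Rightarrow> nat set \<Rightarrow> nat rel \<Rightarrow> (nat \<Rightarrow> nat) \<Rightarrow> bool" where
  "hub n V E g \<longleftrightarrow> ugraph V E \<and> sparse k N E V \<and> card {v \<in> V. g v = 0} = k \<and>
     (\<forall>x y. (x, y) \<in> E \<longrightarrow> g x = g y \<longrightarrow> g x \<noteq> 0) \<and>
     (\<forall>x y. (x, y) \<in> E \<longrightarrow> g x \<noteq> 0 \<longrightarrow> g y \<noteq> 0 \<longrightarrow> g x = g y) \<and>
     (\<forall>v \<in> V. g v = 0 \<longrightarrow> n * (k - 1) \<le> card (E `` {v})) \<and>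
     (\<forall>v \<in> V. g v \<noteq> 0 \<longrightarrow> 2 * k - 2 \<le> card (E `` {v}) + b \<and> {v \<in> V. g v = 0} \<subseteq> E `` {v}) \<and>
     (\<forall>i \<in> {1..n}. card {v \<in> V. g v = i} = k - 1) \<and> (\<forall>v \<in> V. g v \<le> n)"

lemma ex_hub: "\<exists>V E g. hub n V E g"
proof (induction n)
  case 0
  have "\<not> knit k {} Z" if "Z \<subseteq> {..<k}" for Z
    using card_mono[OF _ that] unfolding knit_def by auto
  then have "sparse k N {} {..<k}" unfolding sparse_def by blast
  moreover have "ugraph {..<k} {}" unfolding ugraph_def sym_def irrefl_def by simp
  ultimately have "hub 0 {..<k} {} (\<lambda>_. 0)" unfolding hub_def by simp
  then show ?case by blast
next
  case (Suc n)
  then obtain V E g where H: "hub n V E g" by blast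
  then have ug: "ugraph V E" and sp: "sparse k N E V" and c0: "card {v \<in> V. g v = 0} = k"
    and ind: "\<And>x y. (x, y) \<in> E \<Longrightarrow> g x = g y \<Longrightarrow> g x \<noteq> 0"
    and mono: "\<And>x y. (x, y) \<in> E \<Longrightarrow> g x \<noteq> 0 \<Longrightarrow> g y \<noteq> 0 \<Longrightarrow> g x = g y"
    and deg: "\<And>v. v \<in> V \<Longrightarrow> g v = 0 \<Longrightarrow> n * (k - 1) \<le> card (E `` {v})"
    and uns: "\<And>v. v \<in> V \<Longrightarrow> g v \<noteq> 0 \<Longrightarrow> 2 * k - 2 \<le> card (E `` {v}) + b"
      "\<And>v. v \<in> V \<Longrightarrow> g v \<noteq> 0 \<Longrightarrow> {v \<in> V. g v = 0} \<subseteq> E `` {v}"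
    and c: "\<forall>i \<in> {1..n}. card {v \<in> V. g v = i} = k - 1" and gn: "\<And>v. v \<in> V \<Longrightarrow> g v \<le> n"
    unfolding hub_def by simp_all
  define S where "S = {v \<in> V. g v = 0}"
  have V: "finite V" "E \<subseteq> V \<times> V" using ug unfolding ugraph_def by auto
  have SV: "S \<subseteq> V" and cS: "card S = k" and finS: "finite S" using c0 V(1) unfolding S_def by auto
  have "1 \<le> p" using p k by linarith
  then have cp: "card {v \<in> S. id v = i} \<le> p" for i
    using card_mono[of "{i}" "{v \<in> S. id v = i}"] by (simp add: subset_iff)
  have mS: "id x = id y" if "(x, y) \<in> E" "x \<in> S" "y \<in> S" for x y
    using ind[OF that(1)] that(2,3) unfolding S_def by auto
  obtain C F E' where C: "finite C" "card C = k - 1" "C \<inter> V = {}" and F: "ugraph C F"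
      "\<forall>v \<in> C. k - 2 \<le> card (F `` {v}) + b" and E': "E' = E \<union> F \<union> S \<times> C \<union> C \<times> S"
      and G': "ugraph (V \<union> C) E'" "sparse k N E' (V \<union> C)"
    using attach[OF ug sp SV cS mS cp] by blast
  have FC: "F \<subseteq> C \<times> C" using F(1) unfolding ugraph_def by blast
  define g' where "g' v = (if v \<in> C then Suc n else g v)" for v
  have g'S: "{v \<in> V \<union> C. g' v = 0} = S" using C(3) unfolding g'_def S_def by auto
  have g'V: "v \<notin> C" "g' v = g v" if "v \<in> V" for v using that C(3) unfolding g'_def by auto
  have nbV: "E' `` {v} = E `` {v}" if "v \<in> V - S" for v
    using that C(3) FC E' by blast
  have nbS: "E' `` {v} = E `` {v} \<union> C" if "v \<in> S" for v
    using that C(3) FC E' SV by blast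
  have nbC: "E' `` {v} = F `` {v} \<union> S" if "v \<in> C" for v
    using that C(3) V(2) E' SV by blast
  have dS: "card (E' `` {v}) = card (E `` {v}) + (k - 1)" if "v \<in> S" for v
    unfolding nbS[OF that] using card_Un_disjoint[of "E `` {v}" C] ugraph_finite_nbs[OF ug] C V(2)
    by auto
  have dC: "card (E' `` {v}) = card (F `` {v}) + k" if "v \<in> C" for v
    unfolding nbC[OF that] using card_Un_disjoint[of "F `` {v}" S] ugraph_finite_nbs[OF F(1)] finS cS
      C(3) FC SV by auto
  have edge: "((x, y) \<in> E \<and> x \<in> V \<and> y \<in> V) \<or> (x \<in> C \<and> y \<in> C) \<or> (x \<in> S \<and> y \<in> C) \<or> (x \<in> C \<and> y \<in> S)"
    if "(x, y) \<in> E'" for x y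
    using that FC V(2) E' by auto
  have gS: "g v = 0" if "v \<in> S" for v using that unfolding S_def by simp
  have "g' x \<noteq> 0" if "(x, y) \<in> E'" "g' x = g' y" for x y
    using edge[OF that(1)] that(2) ind[of x y] g'V gS SV unfolding g'_def by (auto split: if_splits)
  moreover have "g' x = g' y" if "(x, y) \<in> E'" "g' x \<noteq> 0" "g' y \<noteq> 0" for x y
    using edge[OF that(1)] that(2,3) mono[of x y] g'V gS SV unfolding g'_def
    by (auto split: if_splits)
  moreover have "Suc n * (k - 1) \<le> card (E' `` {v})" if v: "v \<in> V \<union> C" "g' v = 0" for v
  proof -
    have "v \<in> S" using v g'S by blast
    then show ?thesis using dS[of v] deg[of v] gS[of v] SV by auto
  qed
  moreover have "2 * k - 2 \<le> card (E' `` {v}) + b \<and> {v \<in> V \<union> C. g' v = 0} \<subseteq> E' `` {v}"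
    if v: "v \<in> V \<union> C" "g' v \<noteq> 0" for v
  proof (cases "v \<in> C")
    case True
    have "k - 2 \<le> card (F `` {v}) + b" using F(2) True by blast
    moreover have "S \<subseteq> E' `` {v}" unfolding nbC[OF True] by blast
    ultimately show ?thesis using dC[OF True] unfolding g'S by linarith
  next
    case False
    then have "v \<in> V" "g v \<noteq> 0" using v g'V by auto
    moreover from this have "v \<in> V - S" unfolding S_def by blast
    ultimately show ?thesis using uns[of v] unfolding g'S by (simp add: nbV S_def)
  qed
  moreover have "card {v \<in> V \<union> C. g' v = i} = k - 1" if i: "i \<in> {1..Suc n}" for i
  proof (cases "i = Suc n")
    case True
    have "{v \<in> V \<union> C. g' v = i} = C" using True gn unfolding g'_def by force
    then show ?thesis using C(2) by simp
  next
    case False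
    then have "{v \<in> V \<union> C. g' v = i} = {v \<in> V. g v = i}" using g'V unfolding g'_def by auto
    then show ?thesis using c i False by simp
  qed
  moreover have "g' v \<le> Suc n" if "v \<in> V \<union> C" for v
    using gn[of v] that unfolding g'_def by auto
  moreover have "card {v \<in> V \<union> C. g' v = 0} = k" using g'S cS by simp
  ultimately have "hub (Suc n) (V \<union> C) E' g'" using G' unfolding hub_def by simp
  then show ?case by blast
qed

lemma initial_stage: "\<exists>V E g. stage V E g (k - 1) (k - 1) (k - 1)"
proof -
  obtain V E g where "hub 4 V E g" using ex_hub by blast
  then have *: "ugraph V E" "sparse k N E V" "card {v \<in> V. g v = 0} = k"
     "\<forall>x y. (x, y) \<in> E \<longrightarrow> g x \<noteq> 0 \<longrightarrow> g y \<noteq> 0 \<longrightarrow> g x = g y"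
     "\<forall>v \<in> V. g v = 0 \<longrightarrow> 4 * (k - 1) \<le> card (E `` {v})"
     "\<forall>v \<in> V. g v \<noteq> 0 \<longrightarrow> 2 * k - 2 \<le> card (E `` {v}) + b \<and> {v \<in> V. g v = 0} \<subseteq> E `` {v}"
     "\<forall>i \<in> {1..4}. card {v \<in> V. g v = i} = k - 1" "\<forall>v \<in> V. g v \<le> 4"
    unfolding hub_def by simp_all
  have "k \<le> card {u \<in> E `` {v}. g u = 0}" if "v \<in> V" "g v \<noteq> 0" for v
  proof -
    have "{v \<in> V. g v = 0} \<subseteq> {u \<in> E `` {v}. g u = 0}" using *(6) that by blast
    moreover have "finite {u \<in> E `` {v}. g u = 0}"
      by (rule finite_subset[OF _ ugraph_finite_nbs[OF *(1), of "{v}"]]) blast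
    ultimately show ?thesis using card_mono *(3) by metis
  qed
  moreover have "3 * k - 3 \<le> card (E `` {v}) + b" if "v \<in> V" "g v = 0" for v
    using *(5) that by force
  ultimately have "staged V E g" using *(1,2,4,6) unfolding staged_def by blast
  then show ?thesis using *(7,8) unfolding stage_def by (intro exI[of _ V] exI[of _ E] exI[of _ g]) simp
qed

text \<open>In the steady state the three current gadgets have \<open>s1 + s2 + s3\<close>, \<open>s2 + s3\<close> and \<open>s3\<close>
  unsatisfied vertices, and each further gadget uses up one vertex of the reserve.\<close>

lemma steady_stage:
  assumes "stage V E g (k - 1 - s1) s3 m4"
    and s: "s1 + s2 + s3 = k - 1" "s1 \<le> p" "s2 \<le> p" "s3 \<le> p"
  shows "\<exists>V E g. stage V E g (k - 1 - s1) s3 0"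
  using assms(1)
proof (induction m4 arbitrary: V E g)
  case (Suc m)
  have "k - 1 - s1 - s2 = s3" using s(1) by linarith
  then show ?case using advance[OF Suc.prems s] Suc.IH s(1) by fastforce
qed blast

lemma ex_sparse_min_degree:
  "\<exists>V E. ugraph V E \<and> sparse k N E V \<and> V \<noteq> ({} :: nat set) \<and> (\<forall>v \<in> V. 3 * k - 3 - b \<le> card (E `` {v}))"
proof -
  define s1 s2 s3 where "s1 = (k + 1) div 3" and "s2 = k div 3" and "s3 = (k - 1) div 3"
  have "s1 + s2 + s3 = k - 1" unfolding s1_def s2_def s3_def by (rule sum_thirds)
  moreover have "s3 \<le> s2" "s2 \<le> s1" unfolding s1_def s2_def s3_def by (simp_all add: div_le_mono)
  moreover have "s1 \<le> p" using p unfolding s1_def .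
  ultimately have s: "s1 + s2 + s3 = k - 1" "s3 \<le> s1" "s1 \<le> p" "s2 \<le> p" "s3 \<le> p" by linarith+
  have s3k: "s3 < k - 1" using k unfolding s3_def by (simp add: div_less_dividend)
  obtain V E g where "stage V E g (k - 1) (k - 1) (k - 1)" using initial_stage by blast
  then have "\<exists>V E g. stage V E g (k - 1 - s1) (k - 1 - s2) (k - 1 - 1 + (k - 1 - s3))"
    by (rule advance) (use s k in linarith)+
  then obtain V E g where "stage V E g (k - 1 - s1) (k - 1 - s2) (k - 1 - 1 + (k - 1 - s3))"
    by blast
  then have "\<exists>V E g. stage V E g (k - 1 - s1) (k - 1 - s1 - s2)
      (k - 1 - 1 + (k - 1 - s3) - 1 + (k - 1 - s2 - s3))"
    by (rule advance) (use s s3k in linarith)+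
  moreover have "k - 1 - s1 - s2 = s3" using s(1) by linarith
  ultimately obtain V E g where st: "stage V E g (k - 1 - s1) s3 0"
    using steady_stage[OF _ s(1,3-5)] by (elim exE) metis
  define R where "R = {v \<in> V. g v \<noteq> 0}"
  have ug: "ugraph V E" and sp: "sparse k N E V" using st unfolding stage_def staged_def by auto
  have V: "finite V" "E \<subseteq> V \<times> V" using ug unfolding ugraph_def by auto
  have "{v \<in> V. g v = 4} = {}" using st V(1) unfolding stage_def by simp
  then have "R = {v \<in> V. g v = 1} \<union> {v \<in> V. g v = 2} \<union> {v \<in> V. g v = 3}"
    using st unfolding stage_def R_def by force
  then have "card R = card ({v \<in> V. g v = 1} \<union> {v \<in> V. g v = 2} \<union> {v \<in> V. g v = 3})" by simp
  then have "card R \<le> card {v \<in> V. g v = 1} + card {v \<in> V. g v = 2} + card {v \<in> V. g v = 3}"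
    using card_Un_le[of "{v \<in> V. g v = 1}" "{v \<in> V. g v = 2}"]
      card_Un_le[of "{v \<in> V. g v = 1} \<union> {v \<in> V. g v = 2}" "{v \<in> V. g v = 3}"] by linarith
  then have "card R < 2 * k" using st s k unfolding stage_def by linarith
  moreover have "card {v \<in> V. g v = 1} \<noteq> 0" using st k unfolding stage_def by simp
  then have "V \<noteq> {}" by auto
  moreover have "defective k (3 * k - 3 - b) V E R"
    unfolding defective_def
  proof (intro conjI ballI)
    show "R \<subseteq> V" unfolding R_def by blast
    show "3 * k - 3 - b \<le> card (E `` {v})" if "v \<in> V - R" for v
      using st that unfolding stage_def staged_def R_def by force
    fix v assume "v \<in> R"
    then have v: "2 * k - 2 \<le> card (E `` {v}) + b" "k \<le> card {u \<in> E `` {v}. g u = 0}"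
      using st unfolding stage_def staged_def R_def by auto
    then show "3 * k - 3 - b \<le> card (E `` {v}) + k" by linarith
    have "{u \<in> E `` {v}. g u = 0} \<subseteq> E `` {v} - R" unfolding R_def by auto
    then have "card {u \<in> E `` {v}. g u = 0} \<le> card (E `` {v} - R)"
      using ugraph_finite_nbs[OF ug, of "{v}"] by (intro card_mono) auto
    then show "k \<le> card (E `` {v} - R)" using v(2) by linarith
  qed
  ultimately show ?thesis using complete_defective[OF ug sp] by blast
qed

end

lemma gadgets_complete: "k \<ge> 2 \<Longrightarrow> gadgets k (k + (k + 2) div 3) ((k + 1) div 3) 0"
proof
  fix C :: "nat set" assume k: "k \<ge> 2" and C: "finite C" "card C = k - 1"
  let ?F = "C \<times> C - Id"
  have "ugraph C ?F" using C unfolding ugraph_def sym_def irrefl_def by auto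
  moreover have "k - 2 \<le> card (?F `` {v}) + 0" if "v \<in> C" for v
  proof -
    have "?F `` {v} = C - {v}" using that by auto
    then show ?thesis using that C by simp
  qed
  moreover have "(k + 1) div 3 \<le> (k + 2) div 3" by (rule div_le_mono) simp
  then have "card C + (k + 1) div 3 \<le> k + (k + 2) div 3" using C(2) by linarith
  then have "gadget k (k + (k + 2) div 3) ((k + 1) div 3) C ?F" by (rule complete_gadget[OF C(1)])
  ultimately show "\<exists>F. ugraph C F \<and> (\<forall>v \<in> C. k - 2 \<le> card (F `` {v}) + 0) \<and>
      gadget k (k + (k + 2) div 3) ((k + 1) div 3) C F" by blast
qed auto

lemma gadgets_biclique:
  assumes "k \<ge> 5"
  shows "gadgets k 0 ((k + 1) div 3) ((k + 1) div 3 div 2)"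
proof
  define b where "b = (k + 1) div 3 div 2"
  have "6 * b \<le> k + 1" unfolding b_def by linarith
  then have b: "4 * b \<le> k - 1" "(k + 1) div 3 \<le> 2 * b + 1" using assms unfolding b_def by linarith+
  fix C :: "nat set" assume "finite C" "card C = k - 1"
  then show "\<exists>F. ugraph C F \<and> (\<forall>v \<in> C. k - 2 \<le> card (F `` {v}) + (k + 1) div 3 div 2) \<and>
      gadget k 0 ((k + 1) div 3) C F"
    using biclique_gadget[of C k b] b assms unfolding b_def by simp
qed (use assms in auto)

lemma singleton_graph:
  "\<exists>G :: nat pair_pre_digraph. pair_graph G \<and> pverts G \<noteq> {} \<and> min_degree G = 0 \<and>
     \<not> (\<exists>H. pair_graph H \<and> subgraph (with_proj H) (with_proj G) \<and> vertex_connected (k + 1) H \<and>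
            card (pverts H) > N)"
proof (rule ex_pair_graph[of "{0}" "{}"])
  show "ugraph {0} {}" unfolding ugraph_def sym_def irrefl_def by simp
  show "sparse k N {} {0 :: nat}"
    unfolding sparse_def
  proof (intro allI impI)
    fix Z :: "nat set" assume Z: "Z \<subseteq> {0}" "knit k {} Z"
    then have "k + 1 < card Z" unfolding knit_def by blast
    then show "card Z \<le> N" using card_mono[OF _ Z(1)] by simp
  qed
qed auto

theorem theorem2:
  shows "(\<forall>k::nat. k \<ge> 1 \<longrightarrow>
            (\<exists>G::nat pair_pre_digraph.
               pair_graph G \<and> pverts G \<noteq> {} \<and>
               min_degree G = 3 * k - 3 \<and>
               \<not> (\<exists>H. pair_graph H \<and> subgraph (with_proj H) (with_proj G) \<and>
                      vertex_connected (k + 1) H \<and>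
                      int (card (pverts H)) > \<lceil>4 / 3 * real k\<rceil>)))
       \<and> (\<exists>c::real. \<forall>k::nat. k \<ge> 1 \<longrightarrow>
            (\<exists>G::nat pair_pre_digraph.
               pair_graph G \<and> pverts G \<noteq> {} \<and>
               real (min_degree G) \<ge> (3 - 1 / 6) * real k - c \<and>
               \<not> (\<exists>H. pair_graph H \<and> subgraph (with_proj H) (with_proj G) \<and>
                      vertex_connected (k + 1) H)))"
proof (intro conjI allI impI exI[of _ "20 :: real"])
  fix k :: nat assume "k \<ge> 1"
  define N where "N = k + (k + 2) div 3"
  have "3 * real ((k + 2) div 3) \<le> real k + 2" by linarith
  then have "real N - 1 < 4 / 3 * real k" unfolding N_def by simp
  then have "int N \<le> \<lceil>4 / 3 * real k\<rceil>" by linarith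
  then have N: "N < card A" if "int (card A) > \<lceil>4 / 3 * real k\<rceil>" for A :: "nat set" using that by linarith
  have "\<exists>G :: nat pair_pre_digraph. pair_graph G \<and> pverts G \<noteq> {} \<and> min_degree G = 3 * k - 3 \<and>
      \<not> (\<exists>H. pair_graph H \<and> subgraph (with_proj H) (with_proj G) \<and>
             vertex_connected (k + 1) H \<and> card (pverts H) > N)"
  proof (cases "k = 1")
    case True
    then show ?thesis using singleton_graph[of k N] by simp
  next
    case False
    then interpret gadgets k N "(k + 1) div 3" 0
      unfolding N_def using \<open>k \<ge> 1\<close> by (intro gadgets_complete) simp
    obtain V E where "ugraph V E" "sparse k N E V" "V \<noteq> ({} :: nat set)"
      "\<forall>v \<in> V. 3 * k - 3 - 0 \<le> card (E `` {v})" using ex_sparse_min_degree by blast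
    then show ?thesis using ex_pair_graph[of V E "3 * k - 3" k N] by simp
  qed
  then show "\<exists>G :: nat pair_pre_digraph. pair_graph G \<and> pverts G \<noteq> {} \<and> min_degree G = 3 * k - 3 \<and>
      \<not> (\<exists>H. pair_graph H \<and> subgraph (with_proj H) (with_proj G) \<and>
             vertex_connected (k + 1) H \<and> int (card (pverts H)) > \<lceil>4 / 3 * real k\<rceil>)"
    using N by blast
next
  fix k :: nat assume "k \<ge> 1"
  have "\<exists>G :: nat pair_pre_digraph. pair_graph G \<and> pverts G \<noteq> {} \<and>
      real (min_degree G) \<ge> (3 - 1 / 6) * real k - 20 \<and>
      \<not> (\<exists>H. pair_graph H \<and> subgraph (with_proj H) (with_proj G) \<and>
             vertex_connected (k + 1) H \<and> card (pverts H) > 0)"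
  proof (cases "k \<ge> 5")
    case True
    then interpret gadgets k 0 "(k + 1) div 3" "(k + 1) div 3 div 2" by (rule gadgets_biclique)
    define d where "d = 3 * k - 3 - (k + 1) div 3 div 2"
    obtain V E where "ugraph V E" "sparse k 0 E V" "V \<noteq> ({} :: nat set)"
      "\<forall>v \<in> V. d \<le> card (E `` {v})" using ex_sparse_min_degree unfolding d_def by blast
    then obtain G :: "nat pair_pre_digraph" where G: "pair_graph G" "pverts G \<noteq> {}" "min_degree G = d"
      "\<not> (\<exists>H. pair_graph H \<and> subgraph (with_proj H) (with_proj G) \<and>
             vertex_connected (k + 1) H \<and> card (pverts H) > 0)"
      using ex_pair_graph[of V E d k 0] by blast
    have "6 * ((k + 1) div 3 div 2) \<le> k + 1" by linarith
    then have "6 * d + 19 \<ge> 17 * k" unfolding d_def by linarith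
    then have "6 * real d + 19 \<ge> 17 * real k" by linarith
    then have "real (min_degree G) \<ge> (3 - 1 / 6) * real k - 20" unfolding G(3) by simp
    then show ?thesis using G by blast
  next
    case False
    then have "(3 - 1 / 6) * real k - 20 \<le> real 0" by simp
    then show ?thesis using singleton_graph[of k 0] by metis
  qed
  moreover have "card (pverts H) > 0" if "vertex_connected (k + 1) H" for H :: "nat pair_pre_digraph"
    using that unfolding vertex_connected_def by simp
  ultimately show "\<exists>G :: nat pair_pre_digraph. pair_graph G \<and> pverts G \<noteq> {} \<and>
      real (min_degree G) \<ge> (3 - 1 / 6) * real k - 20 \<and>
      \<not> (\<exists>H. pair_graph H \<and> subgraph (with_proj H) (with_proj G) \<and> vertex_connected (k + 1) H)"
    by blast
qed

end
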